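(* Let $D\subset\mathbb{C}$ be a domain and let $a_1,a_2,\lambda_1,\lambda_2$ be analytic functions on $D$, none of them identically zero, such that there is no constant $\omega$ with $|\omega|=1$ and $\lambda_1=\omega\lambda_2$ on $D$. Let $(P_n)_{n\ge1}$ be a family of polynomials with $P_n(z)=a_1(z)\lambda_1(z)^n+a_2(z)\lambda_2(z)^n$ for $z\in D$. Let $\mathcal{B}=\{z\in D:\ |\lambda_1(z)|=|\lambda_2(z)|\neq0\}$. If there is a non-isolated point of $\mathcal{B}$ lying outside the unit circle (i.e. with $|z|>1$), then the Euclidean Mahler measure $M_e(P_n)$ diverges (to $\infty$) as $n\to\infty$.
   Context: For a nonzero polynomial $f$, the Euclidean Mahler measure is $M_e(f)=\prod_{i}\max(1,|\alpha_i|)$, the product over the nonzero complex roots $\alpha_i$ of $f$ counted with multiplicity (for at most finitely many $n$ can $P_n$ vanish identically; these are disregarded). A point of $\mathcal{B}$ is non-isolated if every neighborhood of it contains other points of $\mathcal{B}$. *)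

theory Defs
  imports "HOL-Complex_Analysis.Complex_Analysis" "HOL-Computational_Algebra.Computational_Algebra"
begin

text \<open>
  The leading coefficient does not enter. The index set is finite for \<open>f \<noteq> 0\<close>; for \<open>f = 0\<close>,
  where the measure is not meant to be defined, the expression takes the dummy value 1.
\<close>
definition euclidean_mahler_measure :: "complex poly \<Rightarrow> real" where
  "euclidean_mahler_measure f =
     (\<Prod>\<alpha> | \<alpha> \<noteq> 0 \<and> poly f \<alpha> = 0. max 1 (cmod \<alpha>) ^ order \<alpha> f)"

definition equimodular_set ::
    "complex set \<Rightarrow> (complex \<Rightarrow> complex) \<Rightarrow> (complex \<Rightarrow> complex) \<Rightarrow> complex set" where
  "equimodular_set D f g = {z \<in> D. cmod (f z) = cmod (g z) \<and> cmod (g z) \<noteq> 0}"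

end

theory Submission
  imports Defs
begin

text \<open>
  Near a point where \<open>lam1\<close> and \<open>lam2\<close> have equal nonzero modulus and \<open>a1\<close>, \<open>a2\<close> do not vanish, write
  \<open>a1 / a2 = exp \<beta>\<close> and \<open>lam1 / lam2 = exp \<gamma>\<close>. The equation \<open>a1 * lam1 ^ n = \<tau> * a2 * lam2 ^ n\<close>
  reads \<open>\<gamma> + \<beta> / n = c\<close> for some \<open>c\<close> on a grid of mesh \<open>2 * pi / n\<close> on the imaginary axis, so by
  Hurwitz's theorem it is solvable near that point for all large \<open>n\<close>. Arbitrarily many such points
  lie in \<open>{z. R < cmod z}\<close> for a fixed \<open>R > 1\<close>, and each contributes a factor of at least \<open>R\<close>
  to the measure. The case \<open>\<tau> = - 1\<close> gives the zeros of \<open>P n\<close>, and \<open>\<tau> = 1\<close> shows that \<open>P n\<close> is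
  not the zero polynomial.
\<close>

section \<open>Solving the exponential equation near an equimodular point\<close>

lemma tendsto_floor_mult_div:
  "(\<lambda>n. of_int \<lfloor>real n * t\<rfloor> / real n) \<longlonglongrightarrow> t"
proof (rule tendsto_sandwich)
  show "\<forall>\<^sub>F n in sequentially. t - 1 / real n \<le> of_int \<lfloor>real n * t\<rfloor> / real n"
    using eventually_gt_at_top[of 0]
  proof eventually_elim
    case (elim n)
    have "real n * t - 1 \<le> of_int \<lfloor>real n * t\<rfloor>"
      by linarith
    then have "(real n * t - 1) / real n \<le> of_int \<lfloor>real n * t\<rfloor> / real n"
      by (intro divide_right_mono) auto
    then show ?case
      using elim by (simp add: diff_divide_distrib)
  qed
  show "\<forall>\<^sub>F n in sequentially. of_int \<lfloor>real n * t\<rfloor> / real n \<le> t"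
    using eventually_gt_at_top[of 0]
    by eventually_elim (simp add: divide_le_eq mult.commute)
  show "(\<lambda>n. t - 1 / real n) \<longlonglongrightarrow> t"
    using tendsto_diff[OF tendsto_const lim_1_over_n] by simp
qed simp

text \<open>If the equation failed for infinitely many \<open>n\<close>, then along these
  \<open>n\<close> the functions \<open>\<gamma> + \<beta> / n - c n\<close> would be zero-free on
  \<open>S\<close>. They converge locally uniformly to the nonconstant function
  \<open>\<gamma> - \<gamma> w\<close>, which vanishes at \<open>w\<close>, against Hurwitz's
  theorem.\<close>

lemma eventually_exp_eq_1:
  fixes \<beta> \<gamma> :: "complex \<Rightarrow> complex"
  assumes S: "open S" "connected S" and w: "w \<in> S"
    and hol: "\<beta> holomorphic_on S" "\<gamma> holomorphic_on S"
    and nonconst: "\<not> \<gamma> constant_on S" and Re0: "Re (\<gamma> w) = 0"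
  shows "\<forall>\<^sub>F n in sequentially. \<exists>z\<in>S. exp (\<beta> z + of_nat n * \<gamma> z) = 1"
proof (rule ccontr)
  \<comment> \<open>The exponents with no solution in \<open>S\<close>; 0 is left out because the
    argument divides by \<open>n\<close>.\<close>
  define N where "N = {n. n > 0 \<and> (\<forall>z\<in>S. exp (\<beta> z + of_nat n * \<gamma> z) \<noteq> 1)}"
  assume "\<not> ?thesis"
  then have "\<exists>\<^sub>F n in sequentially. \<forall>z\<in>S. exp (\<beta> z + of_nat n * \<gamma> z) \<noteq> 1"
    by (simp add: not_eventually)
  from frequently_eventually_conj[OF this eventually_gt_at_top[of 0]]
  have "\<exists>\<^sub>F n in sequentially. n \<in> N"
    by (simp add: N_def)
  then have "infinite N"
    by (simp add: cofinite_eq_sequentially[symmetric] frequently_cofinite)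
  then obtain r :: "nat \<Rightarrow> nat" where r: "strict_mono r" "\<And>n. r n \<in> N"
    using infinite_enumerate by blast
  define t where "t = Im (\<gamma> w) / (2 * pi)"
  \<comment> \<open>\<open>n * c n\<close> is an integer multiple of \<open>2 * pi * \<i>\<close>,
    so \<open>\<gamma> z + \<beta> z / n = c n\<close> would solve the equation. Rounding down makes
    \<open>c n\<close> tend to \<open>\<i> * Im (\<gamma> w)\<close>, which is
    \<open>\<gamma> w\<close> because its real part is 0.\<close>
  define c where "c n = 2 * pi * \<i> * of_real (of_int \<lfloor>real n * t\<rfloor> / real n)" for n
  have "c \<longlonglongrightarrow> 2 * pi * \<i> * of_real t"
    unfolding c_def by (intro tendsto_intros tendsto_floor_mult_div)
  also have "2 * pi * \<i> * of_real t = \<gamma> w"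
    using Re0 by (simp add: complex_eq_iff t_def)
  finally have c: "(\<lambda>n. c (r n)) \<longlonglongrightarrow> \<gamma> w"
    using LIMSEQ_subseq_LIMSEQ[OF _ r(1)] by (simp add: o_def)
  have inv: "(\<lambda>n. 1 / of_nat (r n) :: complex) \<longlonglongrightarrow> 0"
    using LIMSEQ_subseq_LIMSEQ[OF lim_1_over_n r(1)] by (simp add: o_def)
  \<comment> \<open>The absurd conclusion of Hurwitz's theorem, evaluated at the zero
    \<open>w\<close> of the limit function.\<close>
  have "\<gamma> w - \<gamma> w \<noteq> 0"
  proof (rule Hurwitz_no_zeros[OF S, where g = "\<lambda>z. \<gamma> z - \<gamma> w"])
    show "(\<lambda>z. \<gamma> z + 1 / of_nat (r n) * \<beta> z - c (r n)) holomorphic_on S" for n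
      by (intro holomorphic_intros hol)
    show "(\<lambda>z. \<gamma> z - \<gamma> w) holomorphic_on S"
      by (intro holomorphic_intros hol)
    show "\<not> (\<lambda>z. \<gamma> z - \<gamma> w) constant_on S"
    proof
      assume "(\<lambda>z. \<gamma> z - \<gamma> w) constant_on S"
      then obtain d where "\<And>z. z \<in> S \<Longrightarrow> \<gamma> z - \<gamma> w = d"
        unfolding constant_on_def by blast
      then have "\<And>z. z \<in> S \<Longrightarrow> \<gamma> z = d + \<gamma> w"
        by (metis diff_add_cancel)
      with nonconst show False
        unfolding constant_on_def by blast
    qed
    show "uniform_limit K (\<lambda>n z. \<gamma> z + 1 / of_nat (r n) * \<beta> z - c (r n)) (\<lambda>z. \<gamma> z - \<gamma> w) sequentially"
      if K: "compact K" "K \<subseteq> S" for K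
    proof -
      have "bounded (\<beta> ` K)"
        using K hol by (meson compact_continuous_image compact_imp_bounded continuous_on_subset
            holomorphic_on_imp_continuous_on)
      have unif: "uniform_limit K (\<lambda>n z. x n) (\<lambda>z. l) sequentially"
        if "x \<longlonglongrightarrow> l" for x :: "nat \<Rightarrow> complex" and l
        using that by (auto simp: uniform_limit_iff tendsto_iff elim: eventually_mono)
      \<comment> \<open>The term \<open>0 * \<beta> z\<close> matches the product rule for uniform
        limits, which needs \<open>\<beta>\<close> bounded on \<open>K\<close>.\<close>
      have "uniform_limit K (\<lambda>n z. \<gamma> z + 1 / of_nat (r n) * \<beta> z - c (r n))
                   (\<lambda>z. \<gamma> z + 0 * \<beta> z - \<gamma> w) sequentially"
        using \<open>bounded (\<beta> ` K)\<close>
        by (intro uniform_limit_add uniform_limit_minus uniform_lim_mult uniform_limit_const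
            unif c inv) (auto simp: image_constant_conv)
      then show ?thesis by simp
    qed
    show "\<gamma> z + 1 / of_nat (r n) * \<beta> z - c (r n) \<noteq> 0" if "z \<in> S" for n z
    proof
      assume eq: "\<gamma> z + 1 / of_nat (r n) * \<beta> z - c (r n) = 0"
      have pos: "r n > 0" and ne: "exp (\<beta> z + of_nat (r n) * \<gamma> z) \<noteq> 1"
        using r(2)[of n] that by (auto simp: N_def)
      have "\<beta> z + of_nat (r n) * \<gamma> z = of_nat (r n) * c (r n)"
        using eq pos by (simp add: field_simps)
      also have "\<dots> = 2 * of_int \<lfloor>real (r n) * t\<rfloor> * pi * \<i>"
        using pos by (simp add: c_def)
      finally show False
        using ne by (simp add: exp_eq_1 mult_ac)
    qed
  qed (rule w)
  then show False by simp
qed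

text \<open>A ball is contractible, so the zero-free quotients \<open>a / (\<tau> * b)\<close> and
  \<open>f / g\<close> have holomorphic logarithms there. Equal moduli at \<open>w\<close> put the
  logarithm of \<open>f / g\<close> on the imaginary axis at \<open>w\<close>, and
  \<open>ratio\<close> keeps it from being constant.\<close>

lemma eventually_solution_near_equimodular_point:
  fixes a b f g :: "complex \<Rightarrow> complex"
  assumes r: "r > 0"
    and hol: "a holomorphic_on ball w r" "b holomorphic_on ball w r"
      "f holomorphic_on ball w r" "g holomorphic_on ball w r"
    and nz: "\<And>z. z \<in> ball w r \<Longrightarrow> a z \<noteq> 0 \<and> b z \<noteq> 0 \<and> f z \<noteq> 0 \<and> g z \<noteq> 0"
    and eq: "cmod (f w) = cmod (g w)"
    and ratio: "\<not> (\<exists>\<omega>. cmod \<omega> = 1 \<and> (\<forall>z\<in>ball w r. f z = \<omega> * g z))"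
    and \<tau>: "\<tau> \<noteq> 0"
  shows "\<forall>\<^sub>F n in sequentially. \<exists>z\<in>ball w r. a z * f z ^ n = \<tau> * (b z * g z ^ n)"
proof -
  have contr: "contractible (ball w r)"
    by (simp add: convex_imp_contractible)
  obtain \<beta> where \<beta>: "\<beta> holomorphic_on ball w r" "\<And>z. z \<in> ball w r \<Longrightarrow> a z / (\<tau> * b z) = exp (\<beta> z)"
  proof (rule contractible_imp_holomorphic_log[OF _ contr])
    show "(\<lambda>z. a z / (\<tau> * b z)) holomorphic_on ball w r"
      using nz \<tau> by (intro holomorphic_intros hol) auto
  qed (use nz \<tau> in auto)
  obtain \<gamma> where \<gamma>: "\<gamma> holomorphic_on ball w r" "\<And>z. z \<in> ball w r \<Longrightarrow> f z / g z = exp (\<gamma> z)"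
  proof (rule contractible_imp_holomorphic_log[OF _ contr])
    show "(\<lambda>z. f z / g z) holomorphic_on ball w r"
      using nz by (intro holomorphic_intros hol) auto
  qed (use nz in auto)
  have w: "w \<in> ball w r"
    using r by simp
  have "exp (Re (\<gamma> w)) = cmod (f w / g w)"
    using \<gamma>(2)[OF w] by simp
  also have "\<dots> = 1"
    using nz[OF w] eq by (simp add: norm_divide)
  finally have Re0: "Re (\<gamma> w) = 0"
    by simp
  have "\<not> \<gamma> constant_on ball w r"
  proof
    assume "\<gamma> constant_on ball w r"
    then have *: "\<gamma> z = \<gamma> w" if "z \<in> ball w r" for z
      using that w unfolding constant_on_def by metis
    have "f z = exp (\<gamma> w) * g z" if "z \<in> ball w r" for z
      using \<gamma>(2)[OF that] *[OF that] nz[OF that] by (simp add: field_simps)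
    moreover have "cmod (exp (\<gamma> w)) = 1"
      using Re0 by simp
    ultimately show False
      using ratio by blast
  qed
  then have "\<forall>\<^sub>F n in sequentially. \<exists>z\<in>ball w r. exp (\<beta> z + of_nat n * \<gamma> z) = 1"
    by (intro eventually_exp_eq_1[OF _ _ w \<beta>(1) \<gamma>(1) _ Re0]) auto
  then show ?thesis
  proof eventually_elim
    case (elim n)
    then obtain z where z: "z \<in> ball w r" "exp (\<beta> z + of_nat n * \<gamma> z) = 1"
      by blast
    have "a z / (\<tau> * b z) * (f z / g z) ^ n = 1"
      using z \<beta>(2)[OF z(1)] \<gamma>(2)[OF z(1)] by (simp add: exp_add exp_of_nat_mult)
    then have "a z * f z ^ n = \<tau> * (b z * g z ^ n)"
      using nz[OF z(1)] \<tau> by (simp add: power_divide field_simps)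
    then show ?case
      using z(1) by blast
  qed
qed

section \<open>Counting roots outside the unit circle\<close>

text \<open>Each point of \<open>S\<close> is a root of order at least 1 and so contributes a factor
  of at least \<open>R\<close>; all remaining factors are at least 1.\<close>

lemma power_card_le_euclidean_mahler_measure:
  assumes "p \<noteq> 0" and "R > 1" and S: "\<And>\<alpha>. \<alpha> \<in> S \<Longrightarrow> poly p \<alpha> = 0 \<and> R \<le> cmod \<alpha>"
  shows "R ^ card S \<le> euclidean_mahler_measure p"
proof -
  let ?A = "{\<alpha>. \<alpha> \<noteq> 0 \<and> poly p \<alpha> = 0}"
  have fin: "finite ?A"
    using poly_roots_finite[OF \<open>p \<noteq> 0\<close>] by (rule rev_finite_subset) auto
  have sub: "S \<subseteq> ?A"
    using S \<open>R > 1\<close> by fastforce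
  have "R ^ card S = (\<Prod>\<alpha>\<in>S. R)"
    by simp
  also have "\<dots> \<le> (\<Prod>\<alpha>\<in>S. max 1 (cmod \<alpha>) ^ order \<alpha> p)"
  proof (rule prod_mono)
    fix \<alpha> assume \<alpha>: "\<alpha> \<in> S"
    have "order \<alpha> p > 0"
      using S[OF \<alpha>] \<open>p \<noteq> 0\<close> by (simp add: order_gt_0_iff)
    then have "max 1 (cmod \<alpha>) ^ 1 \<le> max 1 (cmod \<alpha>) ^ order \<alpha> p"
      by (intro power_increasing) auto
    then show "0 \<le> R \<and> R \<le> max 1 (cmod \<alpha>) ^ order \<alpha> p"
      using S[OF \<alpha>] \<open>R > 1\<close> by auto
  qed
  also have "\<dots> \<le> (\<Prod>\<alpha>\<in>?A. max 1 (cmod \<alpha>) ^ order \<alpha> p)"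
    by (rule prod_mono2[OF fin sub]) auto
  finally show ?thesis
    by (simp add: euclidean_mahler_measure_def)
qed

text \<open>Half of a positive lower bound for the mutual distances works. This keeps zeros found
  near different points of \<open>T\<close> distinct.\<close>

lemma finite_disjoint_balls:
  fixes T :: "'a :: metric_space set"
  assumes "finite T"
  obtains e where "e > 0" "\<And>x y z. x \<in> T \<Longrightarrow> y \<in> T \<Longrightarrow> dist x z < e \<Longrightarrow> dist y z < e \<Longrightarrow> x = y"
proof -
  have "\<exists>e>0. \<forall>x\<in>T. \<forall>y\<in>T. x \<noteq> y \<longrightarrow> e \<le> dist x y"
  proof -
    have "\<forall>x\<in>T. \<exists>d>0. \<forall>y\<in>T. y \<noteq> x \<longrightarrow> d \<le> dist x y"
      using finite_set_avoid[OF assms] by blast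
    then obtain d where d: "\<And>x. x \<in> T \<Longrightarrow> d x > 0"
      "\<And>x y. x \<in> T \<Longrightarrow> y \<in> T \<Longrightarrow> y \<noteq> x \<Longrightarrow> d x \<le> dist x y"
      by metis
    \<comment> \<open>The extra 1 covers the case of empty \<open>T\<close>.\<close>
    have "Min (insert 1 (d ` T)) > 0"
      using assms d by (subst Min_gr_iff) auto
    moreover have "Min (insert 1 (d ` T)) \<le> d x" if "x \<in> T" for x
      using assms that by (intro Min_le) auto
    ultimately show ?thesis
      using d(2) by (intro exI[of _ "Min (insert 1 (d ` T))"]) (metis order_trans)
  qed
  then obtain e where e: "e > 0" "\<And>x y. x \<in> T \<Longrightarrow> y \<in> T \<Longrightarrow> x \<noteq> y \<Longrightarrow> e \<le> dist x y"
    by blast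
  show ?thesis
  proof (rule that[of "e / 2"])
    show "x = y" if "x \<in> T" "y \<in> T" "dist x z < e / 2" "dist y z < e / 2" for x y z
      using e(2)[of x y] that dist_triangle2[of x y z] by linarith
  qed (use e in auto)
qed

section \<open>Divergence of the Mahler measure\<close>

theorem theorem7:
  fixes D :: "complex set"
    and a1 a2 lam1 lam2 :: "complex \<Rightarrow> complex"
    and P :: "nat \<Rightarrow> complex poly"
  assumes "open D" and "connected D" and "D \<noteq> {}"
    and "a1 analytic_on D" and "a2 analytic_on D"
    and "lam1 analytic_on D" and "lam2 analytic_on D"
    and "\<not> (\<forall>z\<in>D. a1 z = 0)" and "\<not> (\<forall>z\<in>D. a2 z = 0)"
    and "\<not> (\<forall>z\<in>D. lam1 z = 0)" and "\<not> (\<forall>z\<in>D. lam2 z = 0)"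
    and "\<not> (\<exists>\<omega>. cmod \<omega> = 1 \<and> (\<forall>z\<in>D. lam1 z = \<omega> * lam2 z))"
    and "\<And>n z. n \<ge> 1 \<Longrightarrow> z \<in> D \<Longrightarrow> poly (P n) z = a1 z * lam1 z ^ n + a2 z * lam2 z ^ n"
    and "\<exists>z \<in> equimodular_set D lam1 lam2. z islimpt equimodular_set D lam1 lam2 \<and> cmod z > 1"
  shows "filterlim (\<lambda>n. euclidean_mahler_measure (P n)) at_top sequentially"
proof -
  have hol: "a1 holomorphic_on D" "a2 holomorphic_on D" "lam1 holomorphic_on D" "lam2 holomorphic_on D"
    using assms(4-7) by (auto intro: analytic_imp_holomorphic)
  obtain z0 where z0: "z0 \<in> D" "z0 islimpt equimodular_set D lam1 lam2" "cmod z0 > 1"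
    using assms(14) by (auto simp: equimodular_set_def)
  \<comment> \<open>The midpoint of 1 and \<open>cmod z0\<close>.\<close>
  define R where "R = (1 + cmod z0) / 2"
  have R: "R > 1" "R < cmod z0"
    using z0(3) by (auto simp: R_def)
  \<comment> \<open>The point \<open>z0\<close> itself may be missing from \<open>G\<close>, since
    \<open>a1\<close> or \<open>a2\<close> can vanish there.\<close>
  define G where "G = {z \<in> equimodular_set D lam1 lam2. a1 z \<noteq> 0 \<and> a2 z \<noteq> 0 \<and> R < cmod z}"

  \<comment> \<open>Zeros of \<open>a1\<close> and \<open>a2\<close> are isolated, so every
    equimodular point close to \<open>z0\<close>, except possibly \<open>z0\<close>, lies in
    \<open>G\<close>.\<close>
  have "\<forall>\<^sub>F z in at z0. a1 z \<noteq> 0 \<and> z \<in> D" "\<forall>\<^sub>F z in at z0. a2 z \<noteq> 0 \<and> z \<in> D"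
    using assms(8,9) non_zero_neighbour_alt[OF _ assms(1,2) z0(1)] hol by blast+
  moreover have "\<forall>\<^sub>F z in at z0. R < cmod z"
    using R(2) by (intro order_tendstoD(1)[of cmod "cmod z0"] tendsto_intros)
  ultimately have "\<forall>\<^sub>F z in at z0. a1 z \<noteq> 0 \<and> a2 z \<noteq> 0 \<and> R < cmod z"
    by eventually_elim auto
  moreover have "\<exists>\<^sub>F z in at z0. z \<in> equimodular_set D lam1 lam2"
    using z0(2) by (simp add: islimpt_conv_frequently_at)
  ultimately have "\<exists>\<^sub>F z in at z0. z \<in> G"
    unfolding G_def by (simp add: frequently_eventually_frequently)
  then have "infinite G"
    using islimpt_finite islimpt_conv_frequently_at by blast

  \<comment> \<open>The final conjunct, that the second summand is nonzero, is what the case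
    \<open>\<tau> = 1\<close> needs.\<close>
  have solution: "\<forall>\<^sub>F n in sequentially. \<exists>z\<in>D. dist w z < e \<and> R \<le> cmod z \<and>
                    a1 z * lam1 z ^ n = \<tau> * (a2 z * lam2 z ^ n) \<and> a2 z * lam2 z ^ n \<noteq> 0"
    if w: "w \<in> G" and e: "e > 0" and \<tau>: "\<tau> \<noteq> 0" for w e \<tau>
  proof -
    have wD: "w \<in> D" and weq: "cmod (lam1 w) = cmod (lam2 w)"
      and wnz: "a1 w \<noteq> 0" "a2 w \<noteq> 0" "lam1 w \<noteq> 0" "lam2 w \<noteq> 0" and wR: "R < cmod w"
      using w by (auto simp: G_def equimodular_set_def)
    have cont: "isCont a1 w" "isCont a2 w" "isCont lam1 w" "isCont lam2 w"
      using hol wD assms(1) holomorphic_on_imp_continuous_on continuous_on_eq_continuous_at by blast+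
    have nhd: "\<forall>\<^sub>F z in nhds w. h z \<noteq> 0" if "isCont h w" "h w \<noteq> 0" for h :: "complex \<Rightarrow> complex"
      using that tendsto_imp_eventually_ne[of h "h w" "nhds w"]
      by (simp add: continuous_at tendsto_at_iff_tendsto_nhds)
    have "\<forall>\<^sub>F z in nhds w. R < cmod z"
      using wR by (intro order_tendstoD(1)[of cmod "cmod w"] tendsto_norm filterlim_ident)
    moreover have "\<forall>\<^sub>F z in nhds w. z \<in> D"
      using wD assms(1) by (rule eventually_nhds_in_open[rotated])
    moreover have "\<forall>\<^sub>F z in nhds w. dist w z < e"
      using eventually_nhds_in_open[of "ball w e" w] e by simp
    ultimately have "\<forall>\<^sub>F z in nhds w. z \<in> D \<and> dist w z < e \<and> R < cmod z \<and>
                       a1 z \<noteq> 0 \<and> a2 z \<noteq> 0 \<and> lam1 z \<noteq> 0 \<and> lam2 z \<noteq> 0"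
      using nhd[OF cont(1) wnz(1)] nhd[OF cont(2) wnz(2)] nhd[OF cont(3) wnz(3)] nhd[OF cont(4) wnz(4)]
      by eventually_elim auto
    then obtain r where r: "r > 0" "\<And>z. z \<in> ball w r \<Longrightarrow> z \<in> D \<and> dist w z < e \<and> R < cmod z \<and>
                       a1 z \<noteq> 0 \<and> a2 z \<noteq> 0 \<and> lam1 z \<noteq> 0 \<and> lam2 z \<noteq> 0"
      unfolding eventually_nhds_metric by (auto simp: dist_commute)
    then have sub: "ball w r \<subseteq> D"
      by blast
    \<comment> \<open>By the identity theorem a relation on the small ball would extend to all of
      \<open>D\<close>, so the hypothesis on \<open>lam1\<close> and \<open>lam2\<close> also holds
      locally.\<close>
    have "lam1 z = \<omega> * lam2 z" if "\<And>u. u \<in> ball w r \<Longrightarrow> lam1 u = \<omega> * lam2 u" "z \<in> D" for \<omega> z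
    proof (rule analytic_continuation_open[OF open_ball assms(1) _ assms(2) sub hol(3) _ that(1) that(2)])
      show "(\<lambda>z. \<omega> * lam2 z) holomorphic_on D"
        by (intro holomorphic_intros hol)
    qed (use r in auto)
    then have "\<not> (\<exists>\<omega>. cmod \<omega> = 1 \<and> (\<forall>z\<in>ball w r. lam1 z = \<omega> * lam2 z))"
      using assms(12) by blast
    then have "\<forall>\<^sub>F n in sequentially. \<exists>z\<in>ball w r. a1 z * lam1 z ^ n = \<tau> * (a2 z * lam2 z ^ n)"
      using r holomorphic_on_subset[OF _ sub] hol weq \<tau>
      by (intro eventually_solution_near_equimodular_point) auto
    then show ?thesis
    proof eventually_elim
      case (elim n)
      then obtain z where "z \<in> ball w r" "a1 z * lam1 z ^ n = \<tau> * (a2 z * lam2 z ^ n)"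
        by blast
      with r(2)[of z] show ?case
        by (intro bexI[of _ z]) auto
    qed
  qed

  have P_nonzero: "\<forall>\<^sub>F n in sequentially. P n \<noteq> 0"
  proof -
    obtain w where "w \<in> G"
      using \<open>infinite G\<close> by fastforce
    \<comment> \<open>With \<open>\<tau> = 1\<close> the two summands of \<open>P n\<close> agree
      and are nonzero, so they cannot cancel.\<close>
    from solution[OF this zero_less_one one_neq_zero] eventually_ge_at_top[of 1] show ?thesis
    proof eventually_elim
      case (elim n)
      then obtain z where "z \<in> D" "a1 z * lam1 z ^ n = a2 z * lam2 z ^ n" "a2 z * lam2 z ^ n \<noteq> 0"
        by auto
      then have "poly (P n) z = 2 * (a2 z * lam2 z ^ n)"
        using assms(13)[OF elim(2), of z] by simp
      with \<open>a2 z * lam2 z ^ n \<noteq> 0\<close> have "poly (P n) z \<noteq> 0"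
        by simp
      then show ?case
        by auto
    qed
  qed

  have bound: "\<forall>\<^sub>F n in sequentially. R ^ K \<le> euclidean_mahler_measure (P n)" for K
  proof -
    obtain T where T: "T \<subseteq> G" "finite T" "card T = K"
      using infinite_arbitrarily_large[OF \<open>infinite G\<close>] by metis
    obtain e where e: "e > 0"
      "\<And>x y z. x \<in> T \<Longrightarrow> y \<in> T \<Longrightarrow> dist x z < e \<Longrightarrow> dist y z < e \<Longrightarrow> x = y"
      using finite_disjoint_balls[OF T(2)] by metis
    \<comment> \<open>Since \<open>T\<close> is finite, one threshold for \<open>n\<close> serves
      all its points.\<close>
    have "\<forall>\<^sub>F n in sequentially. \<forall>w\<in>T. \<exists>z\<in>D. dist w z < e \<and> R \<le> cmod z \<and>
            a1 z * lam1 z ^ n = - 1 * (a2 z * lam2 z ^ n) \<and> a2 z * lam2 z ^ n \<noteq> 0"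
      using T e(1) by (intro eventually_ball_finite ballI solution) auto
    with P_nonzero eventually_ge_at_top[of 1] show ?thesis
    proof eventually_elim
      case (elim n)
      then obtain \<zeta> where \<zeta>: "\<And>w. w \<in> T \<Longrightarrow> \<zeta> w \<in> D \<and> dist w (\<zeta> w) < e \<and> R \<le> cmod (\<zeta> w) \<and>
          a1 (\<zeta> w) * lam1 (\<zeta> w) ^ n = - 1 * (a2 (\<zeta> w) * lam2 (\<zeta> w) ^ n)"
        by metis
      \<comment> \<open>A common value of \<open>\<zeta>\<close> at two points would be within
        \<open>e\<close> of both, so the choice of \<open>e\<close> identifies them.\<close>
      have "inj_on \<zeta> T"
        using e(2) \<zeta> by (metis inj_onI)
      then have "card (\<zeta> ` T) = K"
        using T(3) by (simp add: card_image)
      moreover have "poly (P n) \<alpha> = 0 \<and> R \<le> cmod \<alpha>" if "\<alpha> \<in> \<zeta> ` T" for \<alpha>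
        using that \<zeta> assms(13)[OF elim(2)] by auto
      ultimately show ?case
        using power_card_le_euclidean_mahler_measure[OF elim(1) R(1)] by metis
    qed
  qed

  show ?thesis
    unfolding filterlim_at_top
  proof
    fix Z :: real
    obtain K where "Z < R ^ K"
      using real_arch_pow[OF R(1)] by blast
    with bound[of K] show "\<forall>\<^sub>F n in sequentially. Z \<le> euclidean_mahler_measure (P n)"
      by (auto elim: eventually_mono)
  qed
qed

end
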